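(* Fix six distinct points $x_1,\ldots,x_6\in\mathbb{R}^3$ that satisfy $$|(x_1,x_3)\cap(x_2,x_4)|=1$$ and $$\left|(x_5,x_6)\cap\left(\mathrm{conv}(\{x_1,x_2,x_3,x_4\})\setminus\bigcup_{\{i,j\}\in\binom{[4]}{2}}[x_i,x_j]\right)\right|=1.$$ Set $L=\{x_1,\ldots,x_6\}$, and for $\varepsilon\geq 0$ define $d_\varepsilon:L\times L\to[0,\infty)$ by $$d_\varepsilon(a,b)=\begin{cases}\|a-b\|+\varepsilon,&\text{if }\{a,b\}=\{x_5,x_6\},\\ \|a-b\|,&\text{if }\{a,b\}\neq\{x_5,x_6\},\end{cases}$$ where $\|\cdot\|$ is the Euclidean norm. Then there exists $C\in(0,\infty)$ such that for any $\varepsilon\in(0,C]$, $(L,d_\varepsilon)$ satisfies the $\mathrm{ANN}(n)$ inequalities for all positive integers $n$.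
   Context: For a positive integer $n$, $[n]=\{1,\ldots,n\}$, and $\binom{[n]}{2}$ is the set of all $2$-element subsets of $[n]$. For points $a,b\in\mathbb{R}^3$, $[a,b]$ is the line segment joining $a$ and $b$, $(a,b)=[a,b]\setminus\{a,b\}$, and $\mathrm{conv}(S)$ is the convex hull of $S\subseteq\mathbb{R}^3$; $|\cdot|$ of a set denotes its cardinality. A semimetric space $(X,d_X)$ is a set with a function satisfying all axioms of a metric space except that the triangle inequality is not required. A semimetric space $(X,d_X)$ satisfies the $\mathrm{ANN}(n)$ inequalities if any points $x_1,\ldots,x_n\in X$ (not necessarily distinct) satisfy $$\frac{1}{2}\sum_{i,j\in[n]\,:\,\pi_{ij}+\pi_{ji}>0}\frac{\pi_{ij}\pi_{ji}}{\pi_{ij}+\pi_{ji}}\,d_X(x_i,x_j)^2\leq\sum_{i=1}^{n}\sum_{j=1}^{n}p_i q_j\, d_X(x_i,x_j)^2$$ for any nonnegative real numbers $p_1,\ldots,p_n,q_1,\ldots,q_n$ with $\sum_{i=1}^n p_i=\sum_{j=1}^n q_j=1$ and any $n\times n$ matrix $(\pi_{ij})$ with nonnegative real entries satisfying $\sum_{k=1}^n\pi_{ik}=p_i+q_i$ for every $i\in[n]$. *)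

theory Defs
  imports "HOL-Analysis.Analysis"
begin

text \<open>A metric space without the triangle inequality. As with
  \<^locale>\<open>Metric_space\<close>, the distance is a total function of which only the
  values on the carrier matter.\<close>

locale Semimetric_space =
  fixes X :: "'a set" and d :: "'a \<Rightarrow> 'a \<Rightarrow> real"
  assumes nonneg: "\<lbrakk>a \<in> X; b \<in> X\<rbrakk> \<Longrightarrow> 0 \<le> d a b"
    and commute: "\<lbrakk>a \<in> X; b \<in> X\<rbrakk> \<Longrightarrow> d a b = d b a"
    and zero: "\<lbrakk>a \<in> X; b \<in> X\<rbrakk> \<Longrightarrow> d a b = 0 \<longleftrightarrow> a = b"

text \<open>The families of points and weights are functions on \<^typ>\<open>nat\<close> of which only
  the values at the indices \<open>1, \<dots>, n\<close> are used.\<close>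

definition ANN_inequalities :: "nat \<Rightarrow> 'a set \<Rightarrow> ('a \<Rightarrow> 'a \<Rightarrow> real) \<Rightarrow> bool" where
  "ANN_inequalities n X d \<longleftrightarrow>
    (\<forall>(x :: nat \<Rightarrow> 'a) (p :: nat \<Rightarrow> real) (q :: nat \<Rightarrow> real) (\<pi> :: nat \<Rightarrow> nat \<Rightarrow> real).
      (\<forall>i\<in>{1..n}. x i \<in> X) \<longrightarrow>
      (\<forall>i\<in>{1..n}. 0 \<le> p i \<and> 0 \<le> q i) \<longrightarrow>
      (\<Sum>i=1..n. p i) = 1 \<longrightarrow>
      (\<Sum>j=1..n. q j) = 1 \<longrightarrow>
      (\<forall>i\<in>{1..n}. \<forall>j\<in>{1..n}. 0 \<le> \<pi> i j) \<longrightarrow>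
      (\<forall>i\<in>{1..n}. (\<Sum>k=1..n. \<pi> i k) = p i + q i) \<longrightarrow>
      1 / 2 * (\<Sum>(i, j) \<in> {(i, j). i \<in> {1..n} \<and> j \<in> {1..n} \<and> \<pi> i j + \<pi> j i > 0}.
                 \<pi> i j * \<pi> j i / (\<pi> i j + \<pi> j i) * (d (x i) (x j))\<^sup>2)
        \<le> (\<Sum>i=1..n. \<Sum>j=1..n. p i * q j * (d (x i) (x j))\<^sup>2))"

definition stretched_dist :: "'a::real_normed_vector \<Rightarrow> 'a \<Rightarrow> real \<Rightarrow> 'a \<Rightarrow> 'a \<Rightarrow> real" where
  "stretched_dist u v \<epsilon> a b = (if {a, b} = {u, v} then norm (a - b) + \<epsilon> else norm (a - b))"

end

(* In Euclidean space the difference of the two sides of ANN(n) is half the sum over i, j of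
   s_ij * |w_ij - a|^2, where a is the barycentre of p, s_ij = pi_ij + pi_ji, and w_ij is the
   barycentre of x_i and x_j with weights pi_ij and pi_ji.  Stretching {x_5, x_6} adds delta * G to
   the left side and delta * R to the right side, where delta is the increase of the squared
   distance, G is the total of pi_ij * pi_ji / s_ij over the occurrences of {x_5, x_6}, and R is
   the corresponding total of p_i * q_j.  If eta is the mass of p + q off x_5 and x_6, then
   (1 - eta) * G <= R, so only delta * eta * G has to be absorbed.  The line through x_5 and x_6
   meets the convex hull of x_1, ..., x_4 in a single point, which lies off the segments
   [x_i, x_j]; so it misses all these segments, and no x_i with i <= 4 lies on it.  Hence w on
   [x_5, x_6] and w' on a segment with an end point among x_1, ..., x_4 are both near a only if
   the weights are degenerate, and the Euclidean difference is at least a constant times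
   eta * G. *)

theory Submission
  imports Defs
begin

section \<open>Moments about barycentres and the Euclidean ANN defect\<close>

text \<open>The parallel axis theorem for masses \<open>\<alpha>\<close> and \<open>\<beta>\<close>
  at \<open>u\<close> and \<open>v\<close>: the moment about their barycentre plus the moment of the
  total mass placed there. If both masses vanish, division by zero makes every term 0.\<close>

lemma weighted_pair_norm_identity:
  fixes u v :: "'a::real_inner"
  assumes "\<alpha> \<ge> 0" "\<beta> \<ge> 0"
  shows "\<alpha> * (norm u)\<^sup>2 + \<beta> * (norm v)\<^sup>2 =
    \<alpha> * \<beta> / (\<alpha> + \<beta>) * (norm (u - v))\<^sup>2 + (norm (\<alpha> *\<^sub>R u + \<beta> *\<^sub>R v))\<^sup>2 / (\<alpha> + \<beta>)"
proof (cases "\<alpha> + \<beta> = 0")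
  case True
  then show ?thesis using assms by (auto simp: add_nonneg_eq_0_iff)
next
  case False
  have "(\<alpha> * (norm u)\<^sup>2 + \<beta> * (norm v)\<^sup>2) * (\<alpha> + \<beta>) =
      \<alpha> * \<beta> * (norm (u - v))\<^sup>2 + (norm (\<alpha> *\<^sub>R u + \<beta> *\<^sub>R v))\<^sup>2"
    by (simp add: power2_norm_eq_inner inner_commute algebra_simps)
  then have "\<alpha> * (norm u)\<^sup>2 + \<beta> * (norm v)\<^sup>2 =
      (\<alpha> * \<beta> * (norm (u - v))\<^sup>2 + (norm (\<alpha> *\<^sub>R u + \<beta> *\<^sub>R v))\<^sup>2) / (\<alpha> + \<beta>)"
    using False by (subst nonzero_eq_divide_eq)
  then show ?thesis by (simp add: add_divide_distrib)
qed

text \<open>The parallel axis theorem for total mass 1: the cross term vanishes because the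
  deviations from \<open>a\<close> have weighted sum 0.\<close>

lemma weighted_sum_dist_identity:
  fixes y :: "'i \<Rightarrow> 'a::real_inner"
  assumes p: "(\<Sum>i\<in>I. p i) = 1" and a: "a = (\<Sum>i\<in>I. p i *\<^sub>R y i)"
  shows "(\<Sum>i\<in>I. p i * (norm (y i - z))\<^sup>2) = (\<Sum>i\<in>I. p i * (norm (y i - a))\<^sup>2) + (norm (a - z))\<^sup>2"
proof -
  have 0: "(\<Sum>i\<in>I. p i *\<^sub>R (y i - a)) = 0"
    using p by (simp add: scaleR_diff_right sum_subtractf a flip: scaleR_sum_left)
  have "p i * (norm (y i - z))\<^sup>2 =
      p i * (norm (y i - a))\<^sup>2 + 2 * inner (p i *\<^sub>R (y i - a)) (a - z) + p i * (norm (a - z))\<^sup>2" for i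
    by (simp add: power2_norm_eq_inner inner_commute algebra_simps)
  then have "(\<Sum>i\<in>I. p i * (norm (y i - z))\<^sup>2) = (\<Sum>i\<in>I. p i * (norm (y i - a))\<^sup>2) +
      2 * inner (\<Sum>i\<in>I. p i *\<^sub>R (y i - a)) (a - z) + (\<Sum>i\<in>I. p i) * (norm (a - z))\<^sup>2"
    by (simp add: sum.distrib sum_distrib_left sum_distrib_right inner_sum_left)
  then show ?thesis using 0 p by simp
qed

text \<open>Taking moments about the barycentre \<open>a\<close> of \<open>p\<close> leaves mass
  \<open>p i + q i\<close> at \<open>y i\<close>. The row sums distribute this mass over pairs, and
  in each pair the two-point identity separates the mutual distance from the displacement of the
  barycentre of the pair. Pairs of weight 0 contribute 0 by division by zero.\<close>

lemma euclidean_ANN_defect: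
  fixes y :: "'i \<Rightarrow> 'a::real_inner" and \<pi> :: "'i \<Rightarrow> 'i \<Rightarrow> real"
  assumes p: "(\<Sum>i\<in>I. p i) = 1" and q: "(\<Sum>i\<in>I. q i) = 1"
    and nn: "\<And>i j. \<lbrakk>i \<in> I; j \<in> I\<rbrakk> \<Longrightarrow> 0 \<le> \<pi> i j"
    and row: "\<And>i. i \<in> I \<Longrightarrow> (\<Sum>k\<in>I. \<pi> i k) = p i + q i"
    and a: "a = (\<Sum>i\<in>I. p i *\<^sub>R y i)"
  shows "(\<Sum>i\<in>I. \<Sum>j\<in>I. p i * q j * (norm (y i - y j))\<^sup>2) =
    1/2 * (\<Sum>i\<in>I. \<Sum>j\<in>I. \<pi> i j * \<pi> j i / (\<pi> i j + \<pi> j i) * (norm (y i - y j))\<^sup>2) +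
    1/2 * (\<Sum>i\<in>I. \<Sum>j\<in>I. (norm (\<pi> i j *\<^sub>R (y i - a) + \<pi> j i *\<^sub>R (y j - a)))\<^sup>2 / (\<pi> i j + \<pi> j i))"
proof -
  define N where "N i = (norm (y i - a))\<^sup>2" for i
  have "(\<Sum>i\<in>I. \<Sum>j\<in>I. p i * q j * (norm (y i - y j))\<^sup>2) =
      (\<Sum>j\<in>I. q j * (\<Sum>i\<in>I. p i * (norm (y i - y j))\<^sup>2))"
    by (subst sum.swap) (simp add: sum_distrib_left mult_ac)
  also have "\<dots> = (\<Sum>j\<in>I. q j * ((\<Sum>i\<in>I. p i * N i) + N j))"
    by (intro sum.cong refl, subst weighted_sum_dist_identity[OF p a]) (simp add: N_def norm_minus_commute)
  also have "\<dots> = (\<Sum>i\<in>I. (p i + q i) * N i)"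
    by (simp add: distrib_left distrib_right sum.distrib q flip: sum_distrib_right)
  also have "\<dots> = (\<Sum>i\<in>I. \<Sum>j\<in>I. \<pi> i j * N i)"
    by (simp add: sum_distrib_right flip: row)
  \<comment> \<open>Symmetrising brings together the two masses \<open>\<pi> i j\<close> and
    \<open>\<pi> j i\<close> carried by one pair.\<close>
  also have "\<dots> = 1/2 * (\<Sum>i\<in>I. \<Sum>j\<in>I. \<pi> i j * N i + \<pi> j i * N j)"
  proof -
    have "(\<Sum>i\<in>I. \<Sum>j\<in>I. \<pi> j i * N j) = (\<Sum>i\<in>I. \<Sum>j\<in>I. \<pi> i j * N i)"
      by (rule sum.swap)
    then show ?thesis by (simp add: sum.distrib)
  qed
  also have "(\<Sum>i\<in>I. \<Sum>j\<in>I. \<pi> i j * N i + \<pi> j i * N j) =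
      (\<Sum>i\<in>I. \<Sum>j\<in>I. \<pi> i j * \<pi> j i / (\<pi> i j + \<pi> j i) * (norm (y i - y j))\<^sup>2 +
        (norm (\<pi> i j *\<^sub>R (y i - a) + \<pi> j i *\<^sub>R (y j - a)))\<^sup>2 / (\<pi> i j + \<pi> j i))"
    unfolding N_def
    by (intro sum.cong refl) (subst weighted_pair_norm_identity, auto simp: nn)
  finally show ?thesis by (simp add: sum.distrib distrib_left)
qed

section \<open>Elementary inequalities for vectors and weights\<close>

text \<open>The parallelogram law for \<open>t *\<^sub>R v\<close> and \<open>s *\<^sub>R w\<close>.
  In the application \<open>v\<close> and \<open>w\<close> are \<open>s\<close> and \<open>t\<close>
  times the displacements of two barycentres from \<open>a\<close>, so \<open>a\<close> drops out of
  the difference on the left.\<close>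

lemma sum_weighted_squares_ge_diff:
  fixes v w :: "'a::real_inner"
  assumes "s > 0" "t > 0"
  shows "(norm (t *\<^sub>R v - s *\<^sub>R w))\<^sup>2 / (2 * s * t) \<le> t * ((norm v)\<^sup>2 / s) + s * ((norm w)\<^sup>2 / t)"
proof -
  have "(norm (t *\<^sub>R v - s *\<^sub>R w))\<^sup>2 =
      2 * (t\<^sup>2 * (norm v)\<^sup>2 + s\<^sup>2 * (norm w)\<^sup>2) - (norm (t *\<^sub>R v + s *\<^sub>R w))\<^sup>2"
    unfolding power2_norm_eq_inner by (simp add: inner_commute algebra_simps power2_eq_square)
  then have "(norm (t *\<^sub>R v - s *\<^sub>R w))\<^sup>2 \<le> 2 * (t\<^sup>2 * (norm v)\<^sup>2 + s\<^sup>2 * (norm w)\<^sup>2)"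
    by simp
  then have "(norm (t *\<^sub>R v - s *\<^sub>R w))\<^sup>2 / (2 * s * t) \<le> 2 * (t\<^sup>2 * (norm v)\<^sup>2 + s\<^sup>2 * (norm w)\<^sup>2) / (2 * s * t)"
    using assms by (intro divide_right_mono) auto
  also have "\<dots> = t * ((norm v)\<^sup>2 / s) + s * ((norm w)\<^sup>2 / t)"
    using assms by (simp add: field_simps power2_eq_square)
  finally show ?thesis .
qed

text \<open>The variables stand for the masses of \<open>p\<close> and \<open>q\<close> at the two
  stretched points. As neither distribution has mass above 1 there,
  \<open>P5 + P6 + Q5 + Q6 - 1\<close> is at most the smaller of \<open>P5 + P6\<close> and
  \<open>Q5 + Q6\<close>, and \<open>key\<close> treats the product with that smaller mass.\<close>

lemma cross_products_ge:
  fixes P5 P6 Q5 Q6 G :: real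
  assumes nn: "0 \<le> P5" "0 \<le> P6" "0 \<le> Q5" "0 \<le> Q6" "0 \<le> G"
    and le1: "P5 + P6 \<le> 1" "Q5 + Q6 \<le> 1"
    and G: "G * (P5 + Q5 + (P6 + Q6)) \<le> (P5 + Q5) * (P6 + Q6)"
  shows "G * (P5 + P6 + Q5 + Q6 - 1) \<le> P5 * Q6 + P6 * Q5"
proof -
  have key: "(P5 + Q5) * (P6 + Q6) * (Q5 + Q6) \<le> (P5 * Q6 + P6 * Q5) * (P5 + Q5 + (P6 + Q6))"
    if nn: "0 \<le> P5" "0 \<le> P6" "0 \<le> Q5" "0 \<le> Q6" and le: "Q5 + Q6 \<le> P5 + P6" for P5 P6 Q5 Q6 :: real
  proof (cases "Q5 + Q6 = 0")
    case True
    then show ?thesis using nn by (auto simp: add_nonneg_eq_0_iff)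
  next
    case False
    then have pos: "Q5 + Q6 > 0" using nn by simp
    \<comment> \<open>Cancelling common terms reduces the claim to
      \<open>Q5 * Q6 * (Q5 + Q6) \<le> P5\<^sup>2 * Q6 + P6\<^sup>2 * Q5\<close>. This follows from
      Cauchy-Schwarz, whose defect is the square below, and from the order of the two
      masses.\<close>
    have "(Q5 + Q6)\<^sup>2 \<le> (P5 + P6)\<^sup>2" using le nn by (intro power_mono) auto
    then have "Q5 * Q6 * (Q5 + Q6)\<^sup>2 \<le> Q5 * Q6 * (P5 + P6)\<^sup>2"
      using nn by (intro mult_left_mono) auto
    moreover have "0 \<le> (P5 * Q6 - P6 * Q5)\<^sup>2" by simp
    ultimately have "(Q5 * Q6 * (Q5 + Q6)) * (Q5 + Q6) \<le> (P5\<^sup>2 * Q6 + P6\<^sup>2 * Q5) * (Q5 + Q6)"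
      by (simp add: algebra_simps power2_eq_square)
    then have "Q5 * Q6 * (Q5 + Q6) \<le> P5\<^sup>2 * Q6 + P6\<^sup>2 * Q5"
      using pos by simp
    then show ?thesis by (simp add: algebra_simps power2_eq_square)
  qed
  let ?A = "P5 + Q5" and ?B = "P6 + Q6"
  let ?R = "P5 * Q6 + P6 * Q5"
  have R: "0 \<le> ?R" using nn by simp
  show ?thesis
  proof (cases "P5 + P6 + Q5 + Q6 \<le> 1")
    case True
    then have "G * (P5 + P6 + Q5 + Q6 - 1) \<le> 0"
      using nn by (intro mult_nonneg_nonpos) auto
    then show ?thesis using R by simp
  next
    case False
    then have pos: "?A + ?B > 0" by simp
    have "?A * ?B * (P5 + P6 + Q5 + Q6 - 1) \<le> ?R * (?A + ?B)"
    proof (cases "Q5 + Q6 \<le> P5 + P6")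
      case True
      have "?A * ?B * (P5 + P6 + Q5 + Q6 - 1) \<le> ?A * ?B * (Q5 + Q6)"
        using nn le1 by (intro mult_left_mono) auto
      also have "\<dots> \<le> ?R * (?A + ?B)" using key[OF nn(1-4) True] by simp
      finally show ?thesis .
    next
      case False
      have "?A * ?B * (P5 + P6 + Q5 + Q6 - 1) \<le> ?A * ?B * (P5 + P6)"
        using nn le1 by (intro mult_left_mono) auto
      also have "\<dots> \<le> ?R * (?A + ?B)"
        using key[OF nn(3,4,1,2)] False by (simp add: algebra_simps)
      finally show ?thesis .
    qed
    moreover have "G * (?A + ?B) * (P5 + P6 + Q5 + Q6 - 1) \<le> ?A * ?B * (P5 + P6 + Q5 + Q6 - 1)"
      using G False by (intro mult_right_mono) auto
    ultimately have "G * (?A + ?B) * (P5 + P6 + Q5 + Q6 - 1) \<le> ?R * (?A + ?B)"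
      by (rule order_trans[rotated])
    moreover have "G * X * Y = G * Y * X" for X Y by simp
    ultimately have "G * (P5 + P6 + Q5 + Q6 - 1) * (?A + ?B) \<le> ?R * (?A + ?B)"
      by (simp only:)
    then show ?thesis using pos by simp
  qed
qed

text \<open>The harmonic term \<open>f g / (f + g)\<close> is the minimum over \<open>\<lambda>\<close> of
  \<open>\<lambda>\<^sup>2 f + (1 - \<lambda>)\<^sup>2 g\<close>; the bound is the choice \<open>\<lambda> = B / (A + B)\<close>.\<close>

lemma sum_harmonic_le:
  fixes f g :: "'i \<Rightarrow> real"
  assumes nn: "\<And>i. i \<in> S \<Longrightarrow> 0 \<le> f i" "\<And>i. i \<in> S \<Longrightarrow> 0 \<le> g i"
    and A: "(\<Sum>i\<in>S. f i) \<le> A" and B: "(\<Sum>i\<in>S. g i) \<le> B"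
  shows "(\<Sum>i\<in>S. f i * g i / (f i + g i)) * (A + B) \<le> A * B"
proof -
  have AB: "0 \<le> A" "0 \<le> B"
    using order_trans[OF sum_nonneg[OF nn(1)] A] order_trans[OF sum_nonneg[OF nn(2)] B] by blast+
  show ?thesis
  proof (cases "A + B = 0")
    case True
    with AB show ?thesis by (simp add: add_nonneg_eq_0_iff)
  next
    case False
    then have pos: "A + B > 0" using AB by simp
    have 1: "f i * g i / (f i + g i) * (A + B)\<^sup>2 \<le> B\<^sup>2 * f i + A\<^sup>2 * g i" if "i \<in> S" for i
    proof (cases "f i + g i = 0")
      case True
      then show ?thesis using nn that by (simp add: add_nonneg_eq_0_iff)
    next
      case False
      then have p: "f i + g i > 0" using nn[OF that] by simp
      have "f i * g i * (A + B)\<^sup>2 \<le> (B\<^sup>2 * f i + A\<^sup>2 * g i) * (f i + g i)"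
        using zero_le_power2[of "B * f i - A * g i"] by (simp add: algebra_simps power2_eq_square)
      then show ?thesis using p by (simp add: pos_divide_le_eq)
    qed
    have "(\<Sum>i\<in>S. f i * g i / (f i + g i)) * (A + B)\<^sup>2 \<le> (\<Sum>i\<in>S. B\<^sup>2 * f i + A\<^sup>2 * g i)"
      unfolding sum_distrib_right by (rule sum_mono) (rule 1)
    also have "\<dots> = B\<^sup>2 * (\<Sum>i\<in>S. f i) + A\<^sup>2 * (\<Sum>i\<in>S. g i)"
      by (simp add: sum.distrib sum_distrib_left)
    also have "\<dots> \<le> B\<^sup>2 * A + A\<^sup>2 * B"
      using A B by (intro add_mono mult_left_mono) auto
    also have "\<dots> = A * B * (A + B)" by (simp add: algebra_simps power2_eq_square)
    finally have "(\<Sum>i\<in>S. f i * g i / (f i + g i)) * (A + B) * (A + B) \<le> A * B * (A + B)"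
      by (simp add: power2_eq_square mult_ac)
    then show ?thesis using pos by simp
  qed
qed

section \<open>Quantitative separation of two segments\<close>

text \<open>For positive total weights \<open>s = \<alpha> + \<beta>\<close> and \<open>t = \<pi> + \<rho>\<close>, the norm below is
  \<open>s t\<close> times the distance between the barycentre \<open>w\<close> of \<open>u, v\<close> and the barycentre \<open>w'\<close> of \<open>k, l\<close>.
  The product form also makes sense for segments with a common end point, where \<open>w = w'\<close> is
  possible only if \<open>\<alpha> \<beta> \<pi> = 0\<close>.\<close>

definition separated_by :: "real \<Rightarrow> 'a \<Rightarrow> 'a \<Rightarrow> 'a \<Rightarrow> 'a::real_inner \<Rightarrow> bool" where
  "separated_by c u v k l \<longleftrightarrow> (\<forall>\<alpha> \<beta> \<pi> \<rho>. 0 \<le> \<alpha> \<longrightarrow> 0 \<le> \<beta> \<longrightarrow> 0 \<le> \<pi> \<longrightarrow> 0 \<le> \<rho> \<longrightarrow>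
     c * (\<alpha> * \<beta> * \<pi> * (\<pi> + \<rho>)) \<le>
     (norm ((\<pi> + \<rho>) *\<^sub>R (\<alpha> *\<^sub>R u + \<beta> *\<^sub>R v) - (\<alpha> + \<beta>) *\<^sub>R (\<pi> *\<^sub>R k + \<rho> *\<^sub>R l)))\<^sup>2)"

lemma separated_by_mono:
  assumes "separated_by c u v k l" "c' \<le> c"
  shows "separated_by c' u v k l"
  unfolding separated_by_def
proof (intro allI impI)
  fix \<alpha> \<beta> \<pi> \<rho> :: real
  assume nn: "0 \<le> \<alpha>" "0 \<le> \<beta>" "0 \<le> \<pi>" "0 \<le> \<rho>"
  have "c' * (\<alpha> * \<beta> * \<pi> * (\<pi> + \<rho>)) \<le> c * (\<alpha> * \<beta> * \<pi> * (\<pi> + \<rho>))"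
    using nn assms(2) by (intro mult_right_mono) auto
  also have "\<dots> \<le> (norm ((\<pi> + \<rho>) *\<^sub>R (\<alpha> *\<^sub>R u + \<beta> *\<^sub>R v) - (\<alpha> + \<beta>) *\<^sub>R (\<pi> *\<^sub>R k + \<rho> *\<^sub>R l)))\<^sup>2"
    using assms(1) nn unfolding separated_by_def by blast
  finally show "c' * (\<alpha> * \<beta> * \<pi> * (\<pi> + \<rho>)) \<le>
     (norm ((\<pi> + \<rho>) *\<^sub>R (\<alpha> *\<^sub>R u + \<beta> *\<^sub>R v) - (\<alpha> + \<beta>) *\<^sub>R (\<pi> *\<^sub>R k + \<rho> *\<^sub>R l)))\<^sup>2" .
qed

lemma separated_by_swap:
  assumes "separated_by c u v k l"
  shows "separated_by c v u k l"
  unfolding separated_by_def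
proof (intro allI impI)
  fix \<alpha> \<beta> \<pi> \<rho> :: real
  assume "0 \<le> \<alpha>" "0 \<le> \<beta>" "0 \<le> \<pi>" "0 \<le> \<rho>"
  then have "c * (\<beta> * \<alpha> * \<pi> * (\<pi> + \<rho>)) \<le>
     (norm ((\<pi> + \<rho>) *\<^sub>R (\<beta> *\<^sub>R u + \<alpha> *\<^sub>R v) - (\<beta> + \<alpha>) *\<^sub>R (\<pi> *\<^sub>R k + \<rho> *\<^sub>R l)))\<^sup>2"
    using assms unfolding separated_by_def by blast
  then show "c * (\<alpha> * \<beta> * \<pi> * (\<pi> + \<rho>)) \<le>
     (norm ((\<pi> + \<rho>) *\<^sub>R (\<alpha> *\<^sub>R v + \<beta> *\<^sub>R u) - (\<alpha> + \<beta>) *\<^sub>R (\<pi> *\<^sub>R k + \<rho> *\<^sub>R l)))\<^sup>2"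
    by (simp only: add.commute[of "\<beta> *\<^sub>R u"] add.commute[of \<beta>] mult.commute[of \<beta>])
qed

lemma separated_by_uniform:
  assumes "finite S" "\<And>k l. (k, l) \<in> S \<Longrightarrow> \<exists>c>0. separated_by c u v k l"
  shows "\<exists>c>0. \<forall>(k, l)\<in>S. separated_by c u v k l"
  using assms
proof (induction S rule: finite_induct)
  case empty
  show ?case by (intro exI[of _ 1]) simp
next
  case (insert e S)
  obtain k l where e: "e = (k, l)" by (cases e)
  obtain c where c: "c > 0" "separated_by c u v k l" using insert.prems[of k l] e by auto
  obtain d where d: "d > 0" "\<forall>(k, l)\<in>S. separated_by d u v k l" using insert by auto
  show ?case
    using c d e by (intro exI[of _ "min c d"]) (auto intro: separated_by_mono)
qed

text \<open>Disjoint compact segments have a positive distance \<open>d\<close>. For total weights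
  \<open>s\<close> and \<open>t\<close> the norm is thus at least \<open>s * t * d\<close>, while
  \<open>\<alpha> * \<beta> \<le> s\<^sup>2\<close> and \<open>\<pi> \<le> t\<close>.\<close>

lemma separated_by_disjoint:
  fixes u v k l :: "'a::euclidean_space"
  assumes "closed_segment u v \<inter> closed_segment k l = {}"
  shows "\<exists>c>0. separated_by c u v k l"
proof -
  obtain d where d: "d > 0" "\<And>z w. \<lbrakk>z \<in> closed_segment u v; w \<in> closed_segment k l\<rbrakk> \<Longrightarrow> d \<le> dist z w"
    using separate_compact_closed[of "closed_segment u v" "closed_segment k l"] assms by auto
  have "separated_by (d\<^sup>2) u v k l"
    unfolding separated_by_def
  proof (intro allI impI)
    fix \<alpha> \<beta> \<pi> \<rho> :: real
    assume nn: "0 \<le> \<alpha>" "0 \<le> \<beta>" "0 \<le> \<pi>" "0 \<le> \<rho>"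
    let ?s = "\<alpha> + \<beta>" and ?t = "\<pi> + \<rho>"
    let ?V = "?t *\<^sub>R (\<alpha> *\<^sub>R u + \<beta> *\<^sub>R v) - ?s *\<^sub>R (\<pi> *\<^sub>R k + \<rho> *\<^sub>R l)"
    show "d\<^sup>2 * (\<alpha> * \<beta> * \<pi> * ?t) \<le> (norm ?V)\<^sup>2"
    proof (cases "?s = 0 \<or> ?t = 0")
      case True
      then show ?thesis using nn by (auto simp: add_nonneg_eq_0_iff)
    next
      case False
      then have pos: "?s > 0" "?t > 0" using nn by auto
      define z w where "z = (\<alpha> / ?s) *\<^sub>R u + (\<beta> / ?s) *\<^sub>R v" and "w = (\<pi> / ?t) *\<^sub>R k + (\<rho> / ?t) *\<^sub>R l"
      have "z \<in> closed_segment u v"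
        unfolding z_def in_segment using pos nn
        by (intro exI[of _ "\<beta> / ?s"]) (auto simp: field_simps intro!: arg_cong2[where f="(+)"] arg_cong2[where f=scaleR])
      moreover have "w \<in> closed_segment k l"
        unfolding w_def in_segment using pos nn
        by (intro exI[of _ "\<rho> / ?t"]) (auto simp: field_simps intro!: arg_cong2[where f="(+)"] arg_cong2[where f=scaleR])
      ultimately have "d \<le> norm (z - w)" using d(2) by (simp add: dist_norm)
      then have "?s * ?t * d \<le> ?s * ?t * norm (z - w)" using pos by simp
      also have "\<dots> = norm ((?s * ?t) *\<^sub>R (z - w))" using pos by simp
      also have "(?s * ?t) *\<^sub>R (z - w) = ?V"
        using pos by (simp add: z_def w_def scaleR_diff_right scaleR_add_right)
      finally have "(?s * ?t * d)\<^sup>2 \<le> (norm ?V)\<^sup>2"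
        using pos d(1) by (intro power_mono) auto
      moreover have "\<alpha> * \<beta> * (\<pi> * ?t) \<le> (?s * ?s) * (?t * ?t)"
        using nn by (intro mult_mono) auto
      then have "d\<^sup>2 * (\<alpha> * \<beta> * \<pi> * ?t) \<le> (?s * ?t * d)\<^sup>2"
        using d(1) by (simp add: power2_eq_square mult_ac)
      ultimately show ?thesis by linarith
    qed
  qed
  then show ?thesis using d(1) by (intro exI[of _ "d\<^sup>2"]) auto
qed

text \<open>Strict Cauchy-Schwarz means that the rays from \<open>u\<close> to \<open>v\<close> and
  to \<open>k\<close> differ. Once the common end point cancels, a combination
  \<open>\<mu> *\<^sub>R (v - u) - \<nu> *\<^sub>R (k - u)\<close> remains, with squared length at
  least a constant times \<open>\<mu> * \<nu>\<close>.\<close>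

lemma separated_by_adjacent:
  fixes u v k :: "'a::real_inner"
  assumes "inner (v - u) (k - u) \<noteq> norm (v - u) * norm (k - u)"
  shows "\<exists>c>0. separated_by c u v k u"
proof -
  \<comment> \<open>This is the coefficient of \<open>\<mu> * \<nu>\<close> that remains when the
    square of the difference of the two lengths is split off.\<close>
  define c where "c = 2 * (norm (v - u) * norm (k - u) - inner (v - u) (k - u))"
  have c: "c > 0" using assms norm_cauchy_schwarz[of "v - u" "k - u"] by (simp add: c_def)
  have "separated_by c u v k u"
    unfolding separated_by_def
  proof (intro allI impI)
    fix \<alpha> \<beta> \<pi> \<rho> :: real
    assume nn: "0 \<le> \<alpha>" "0 \<le> \<beta>" "0 \<le> \<pi>" "0 \<le> \<rho>"
    let ?s = "\<alpha> + \<beta>" and ?t = "\<pi> + \<rho>"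
    define \<mu> \<nu> where "\<mu> = ?t * \<beta>" and "\<nu> = ?s * \<pi>"
    have "\<alpha> * (\<beta> * \<pi> * ?t) \<le> ?s * (\<beta> * \<pi> * ?t)" using nn by (intro mult_right_mono) auto
    then have "\<alpha> * \<beta> * \<pi> * ?t \<le> \<mu> * \<nu>" by (simp add: \<mu>_def \<nu>_def mult_ac)
    then have "c * (\<alpha> * \<beta> * \<pi> * ?t) \<le> c * (\<mu> * \<nu>)"
      using c by (intro mult_left_mono) auto
    also have "\<dots> \<le> (norm (\<mu> *\<^sub>R (v - u) - \<nu> *\<^sub>R (k - u)))\<^sup>2"
    proof -
      have "(norm (\<mu> *\<^sub>R e - \<nu> *\<^sub>R f))\<^sup>2 =
          (\<mu> * norm e - \<nu> * norm f)\<^sup>2 + 2 * (norm e * norm f - inner e f) * (\<mu> * \<nu>)" for e f :: 'a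
        by (simp add: power2_diff power_mult_distrib power2_norm_eq_inner inner_commute algebra_simps)
          (simp add: power2_eq_square algebra_simps)
      then show ?thesis by (simp add: c_def)
    qed
    also have "\<mu> *\<^sub>R (v - u) - \<nu> *\<^sub>R (k - u) = ?t *\<^sub>R (\<alpha> *\<^sub>R u + \<beta> *\<^sub>R v) - ?s *\<^sub>R (\<pi> *\<^sub>R k + \<rho> *\<^sub>R u)"
      by (simp add: \<mu>_def \<nu>_def algebra_simps)
    finally show "c * (\<alpha> * \<beta> * \<pi> * ?t) \<le> (norm (?t *\<^sub>R (\<alpha> *\<^sub>R u + \<beta> *\<^sub>R v) - ?s *\<^sub>R (\<pi> *\<^sub>R k + \<rho> *\<^sub>R u)))\<^sup>2" .
  qed
  then show ?thesis using c by blast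
qed

section \<open>Lines that meet a convex hull off a closed set\<close>

text \<open>A short move from \<open>w\<close> towards \<open>y\<close> stays in \<open>K\<close> by
  convexity, off \<open>E\<close> by closedness, and inside the open segment. If \<open>y\<close>
  differs from \<open>w\<close>, this yields a second point of the intersection. The parameter
  \<open>t\<close> ranges over the whole line.\<close>

lemma convex_Int_line_eq_singleton:
  fixes u v :: "'a::euclidean_space"
  assumes S: "open_segment u v \<inter> (K - E) = {w}" and K: "convex K" and E: "closed E"
    and yK: "y \<in> K" and y: "y = u + t *\<^sub>R (v - u)"
  shows "y = w"
proof (rule ccontr)
  assume ne: "y \<noteq> w"
  have w: "w \<in> open_segment u v" "w \<in> K" "w \<notin> E" using S by auto
  then obtain r where r: "0 < r" "r < 1" "w = u + r *\<^sub>R (v - u)" and uv: "u \<noteq> v"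
    by (auto simp: in_segment algebra_simps)
  define g where "g \<tau> = w + \<tau> *\<^sub>R (y - w)" for \<tau> :: real
  have lim: "((\<lambda>\<tau>. g \<tau>) \<longlongrightarrow> w) (at_right 0)"
    unfolding g_def by (auto intro!: tendsto_eq_intros)
  \<comment> \<open>\<open>r + \<tau> * (t - r)\<close> is the parameter of \<open>g \<tau>\<close>
    on the line through \<open>u\<close> and \<open>v\<close>.\<close>
  have lim': "((\<lambda>\<tau>. r + \<tau> * (t - r)) \<longlongrightarrow> r) (at_right 0)"
    by (auto intro!: tendsto_eq_intros)
  have "\<forall>\<^sub>F \<tau> in at_right 0. g \<tau> \<in> - E"
    using topological_tendstoD[OF lim, of "- E"] E w by (simp add: open_Compl)
  moreover have "\<forall>\<^sub>F \<tau> in at_right 0. r + \<tau> * (t - r) \<in> {0<..<1}"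
    using topological_tendstoD[OF lim', of "{0<..<1}"] r by simp
  moreover have "\<forall>\<^sub>F \<tau> in at_right (0::real). \<tau> \<in> {0<..<1}"
    by (rule eventually_at_right_real) simp
  ultimately have "\<forall>\<^sub>F \<tau> in at_right 0. g \<tau> \<in> - E \<and> r + \<tau> * (t - r) \<in> {0<..<1} \<and> \<tau> \<in> {0<..<1}"
    by eventually_elim auto
  then obtain \<tau> where \<tau>: "g \<tau> \<notin> E" "0 < r + \<tau> * (t - r)" "r + \<tau> * (t - r) < 1" "0 < \<tau>" "\<tau> < 1"
    using eventually_happens by (fastforce simp: trivial_limit_at_right_real)
  have "g \<tau> = (1 - \<tau>) *\<^sub>R w + \<tau> *\<^sub>R y" by (simp add: g_def algebra_simps)
  then have "g \<tau> \<in> K" using K w yK \<tau> by (simp add: convexD_alt)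
  moreover have "g \<tau> = (1 - (r + \<tau> * (t - r))) *\<^sub>R u + (r + \<tau> * (t - r)) *\<^sub>R v"
    by (simp add: g_def y r algebra_simps)
  then have "g \<tau> \<in> open_segment u v"
    using \<tau> uv unfolding in_segment by blast
  ultimately have "g \<tau> = w" using \<tau>(1) S by blast
  then show False using \<tau>(4) ne by (simp add: g_def)
qed

text \<open>The line through \<open>u\<close> and \<open>v\<close> meets the hull at most in
  \<open>w\<close>, which is off \<open>E\<close>. So it contains no point of \<open>W\<close> and
  misses every segment within \<open>W\<close>: for \<open>l\<close> in \<open>W\<close> the
  segments are disjoint, and for \<open>l\<close> equal to \<open>u\<close> or \<open>v\<close> they
  share an end point without being collinear.\<close>

lemma crossing_segment_separated:
  fixes u v :: "'a::euclidean_space"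
  assumes uv: "u \<noteq> v" and W: "finite W"
    and S: "open_segment u v \<inter> (convex hull W - E) = {w}" and E: "closed E"
    and WE: "\<And>k l. \<lbrakk>k \<in> W; l \<in> W\<rbrakk> \<Longrightarrow> closed_segment k l \<subseteq> E"
  shows "u \<notin> W \<and> v \<notin> W \<and>
    (\<exists>c>0. \<forall>(k, l)\<in>W \<times> insert u (insert v W). separated_by c u v k l)"
proof -
  note on_line = convex_Int_line_eq_singleton[OF S convex_convex_hull E]
  have wE: "w \<notin> E" using S by blast
  have off: "k \<noteq> u + t *\<^sub>R (v - u)" if "k \<in> W" for k t
  proof
    assume "k = u + t *\<^sub>R (v - u)"
    then have "k = w" using on_line hull_inc[OF that] by blast
    \<comment> \<open>The degenerate segment from \<open>k\<close> to \<open>k\<close> lies in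
      \<open>E\<close>, so \<open>k\<close> does.\<close>
    then show False using WE[OF that that] wE by simp
  qed
  have disj: "closed_segment u v \<inter> closed_segment k l = {}" if kl: "k \<in> W" "l \<in> W" for k l
  proof (rule ccontr)
    assume "closed_segment u v \<inter> closed_segment k l \<noteq> {}"
    then obtain z where z: "z \<in> closed_segment k l" "z \<in> closed_segment u v" by blast
    obtain t where t: "z = u + t *\<^sub>R (v - u)"
      using z(2) by (auto simp: in_segment algebra_simps)
    have "closed_segment k l \<subseteq> convex hull W"
      using kl by (intro closed_segment_subset) (auto intro: hull_inc)
    then have "z = w" using z t by (intro on_line) auto
    then show False using WE[OF kl] z wE by blast
  qed
  have adj: "inner (b - a) (k - a) \<noteq> norm (b - a) * norm (k - a)"
    if ab: "(a, b) = (u, v) \<or> (a, b) = (v, u)" and k: "k \<in> W" for a b k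
  proof
    assume "inner (b - a) (k - a) = norm (b - a) * norm (k - a)"
    then have eq: "norm (b - a) *\<^sub>R (k - a) = norm (k - a) *\<^sub>R (b - a)"
      by (simp add: norm_cauchy_schwarz_eq)
    define t where "t = inverse (norm (b - a)) * norm (k - a)"
    have "norm (b - a) \<noteq> 0" using ab uv by auto
    then have "k - a = inverse (norm (b - a)) *\<^sub>R (norm (b - a) *\<^sub>R (k - a))" by simp
    also have "\<dots> = t *\<^sub>R (b - a)" by (simp add: eq t_def)
    finally have t: "k = a + t *\<^sub>R (b - a)" by (simp only: diff_eq_eq add.commute)
    have "k = u + t *\<^sub>R (v - u) \<or> k = u + (1 - t) *\<^sub>R (v - u)"
      using ab t by (auto simp: algebra_simps)
    then show False using off[OF k] by blast
  qed
  have "\<exists>c>0. separated_by c u v k l" if k: "k \<in> W" and l: "l \<in> insert u (insert v W)" for k l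
  proof -
    consider "l = u" | "l = v" | "l \<in> W" using l by blast
    then show ?thesis
    proof cases
      case 1
      then show ?thesis using separated_by_adjacent[OF adj, of u v k] k by simp
    next
      case 2
      have "\<exists>c>0. separated_by c v u k v"
        by (rule separated_by_adjacent[OF adj]) (use k in simp_all)
      then show ?thesis using 2 separated_by_swap by blast
    next
      case 3
      then show ?thesis by (intro separated_by_disjoint disj k)
    qed
  qed
  then have "\<exists>c>0. \<forall>(k, l)\<in>W \<times> insert u (insert v W). separated_by c u v k l"
    using W by (intro separated_by_uniform) simp_all
  moreover have "u \<notin> W" "v \<notin> W" using off[of u 0] off[of v 1] by auto
  ultimately show ?thesis by simp
qed

section \<open>The ANN inequalities after stretching one pair\<close>

text \<open>\<open>u \<noteq> v\<close> keeps the stretch off the diagonal.\<close>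

lemma Semimetric_space_stretched_dist:
  assumes "u \<noteq> v" "0 \<le> \<epsilon>"
  shows "Semimetric_space X (stretched_dist u v \<epsilon>)"
proof
  fix a b
  show "0 \<le> stretched_dist u v \<epsilon> a b" using assms by (simp add: stretched_dist_def)
  show "stretched_dist u v \<epsilon> a b = stretched_dist u v \<epsilon> b a"
    by (simp add: stretched_dist_def norm_minus_commute insert_commute)
  show "stretched_dist u v \<epsilon> a b = 0 \<longleftrightarrow> a = b"
    using assms by (auto simp: stretched_dist_def doubleton_eq_iff add_nonneg_eq_0_iff)
qed

text \<open>The Euclidean identity reduces the claim to \<open>\<delta> * (2 * G) \<le> 2 *
  (\<delta> * (P5 * Q6 + P6 * Q5)) + Tot\<close>. The cross products absorb the share
  \<open>1 - \<eta>\<close> of \<open>G\<close>, and separation lets the defect \<open>Tot\<close>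
  absorb the share \<open>\<eta>\<close>.\<close>

lemma ANN_of_separated:
  fixes y :: "'i \<Rightarrow> 'a::real_inner" and \<pi> :: "'i \<Rightarrow> 'i \<Rightarrow> real"
  assumes fin: "finite I"
    and pq: "\<And>i. i \<in> I \<Longrightarrow> 0 \<le> p i" "\<And>i. i \<in> I \<Longrightarrow> 0 \<le> q i"
    and p: "(\<Sum>i\<in>I. p i) = 1" and q: "(\<Sum>i\<in>I. q i) = 1"
    and nn: "\<And>i j. \<lbrakk>i \<in> I; j \<in> I\<rbrakk> \<Longrightarrow> 0 \<le> \<pi> i j"
    and row: "\<And>i. i \<in> I \<Longrightarrow> (\<Sum>k\<in>I. \<pi> i k) = p i + q i"
    and y: "\<And>i. i \<in> I \<Longrightarrow> y i \<in> insert u (insert v W)"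
    and uvW: "u \<noteq> v" "u \<notin> W" "v \<notin> W"
    and sep: "\<And>k l. \<lbrakk>k \<in> W; l \<in> insert u (insert v W)\<rbrakk> \<Longrightarrow> separated_by c u v k l"
    and \<delta>: "0 \<le> \<delta>" "32 * \<delta> \<le> c"
  defines "D \<equiv> \<lambda>i j. (norm (y i - y j))\<^sup>2 + (if {y i, y j} = {u, v} then \<delta> else 0)"
  shows "1/2 * (\<Sum>i\<in>I. \<Sum>j\<in>I. \<pi> i j * \<pi> j i / (\<pi> i j + \<pi> j i) * D i j)
    \<le> (\<Sum>i\<in>I. \<Sum>j\<in>I. p i * q j * D i j)"
proof -
  \<comment> \<open>Points may repeat in \<open>y\<close>, so indices are grouped by their location:
    \<open>u\<close>, \<open>v\<close> or \<open>W\<close>.\<close>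
  define U V F where "U = {i\<in>I. y i = u}" and "V = {i\<in>I. y i = v}" and "F = {i\<in>I. y i \<in> W}"
  have sub: "U \<subseteq> I" "V \<subseteq> I" "F \<subseteq> I" and finU: "finite U" "finite V" "finite F"
    using fin by (auto simp: U_def V_def F_def)
  have split: "sum h I = sum h U + sum h V + sum h F" for h :: "'i \<Rightarrow> real"
  proof -
    have "I = U \<union> V \<union> F" using y by (auto simp: U_def V_def F_def)
    moreover have "(U \<union> V) \<inter> F = {}" "U \<inter> V = {}" using uvW by (auto simp: U_def V_def F_def)
    ultimately show ?thesis using finU by (simp add: sum.union_disjoint)
  qed
  have extra: "(\<Sum>i\<in>I. \<Sum>j\<in>I. f i j * (if {y i, y j} = {u, v} then \<delta> else 0)) =
      \<delta> * ((\<Sum>i\<in>U. \<Sum>j\<in>V. f i j) + (\<Sum>i\<in>V. \<Sum>j\<in>U. f i j))" for f :: "'i \<Rightarrow> 'i \<Rightarrow> real"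
  proof -
    have "(\<Sum>j\<in>I. f i j * (if {y i, y j} = {u, v} then \<delta> else 0)) = \<delta> * (\<Sum>j\<in>V. f i j)" if "i \<in> U" for i
    proof -
      have "(\<Sum>j\<in>U. f i j * (if {y i, y j} = {u, v} then \<delta> else 0)) = 0"
        "(\<Sum>j\<in>F. f i j * (if {y i, y j} = {u, v} then \<delta> else 0)) = 0"
        "(\<Sum>j\<in>V. f i j * (if {y i, y j} = {u, v} then \<delta> else 0)) = (\<Sum>j\<in>V. \<delta> * f i j)"
        using that uvW
        by (auto simp: U_def V_def F_def doubleton_eq_iff intro!: sum.neutral sum.cong)
      then show ?thesis by (simp add: split sum_distrib_left)
    qed
    moreover have "(\<Sum>j\<in>I. f i j * (if {y i, y j} = {u, v} then \<delta> else 0)) = \<delta> * (\<Sum>j\<in>U. f i j)" if "i \<in> V" for i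
    proof -
      have "(\<Sum>j\<in>V. f i j * (if {y i, y j} = {u, v} then \<delta> else 0)) = 0"
        "(\<Sum>j\<in>F. f i j * (if {y i, y j} = {u, v} then \<delta> else 0)) = 0"
        "(\<Sum>j\<in>U. f i j * (if {y i, y j} = {u, v} then \<delta> else 0)) = (\<Sum>j\<in>U. \<delta> * f i j)"
        using that uvW
        by (auto simp: U_def V_def F_def doubleton_eq_iff intro!: sum.neutral sum.cong)
      then show ?thesis by (simp add: split sum_distrib_left)
    qed
    moreover have "(\<Sum>j\<in>I. f i j * (if {y i, y j} = {u, v} then \<delta> else 0)) = 0" if "i \<in> F" for i
      using that uvW by (auto simp: F_def doubleton_eq_iff intro!: sum.neutral)
    ultimately show ?thesis
      by (simp add: split[of "\<lambda>i. \<Sum>j\<in>I. f i j * (if {y i, y j} = {u, v} then \<delta> else 0)"]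
          distrib_left sum_distrib_left)
  qed
  have stretch: "(\<Sum>i\<in>I. \<Sum>j\<in>I. f i j * D i j) = (\<Sum>i\<in>I. \<Sum>j\<in>I. f i j * (norm (y i - y j))\<^sup>2) +
      \<delta> * ((\<Sum>i\<in>U. \<Sum>j\<in>V. f i j) + (\<Sum>i\<in>V. \<Sum>j\<in>U. f i j))" for f :: "'i \<Rightarrow> 'i \<Rightarrow> real"
    unfolding D_def by (simp only: distrib_left sum.distrib extra[of f])
  define g where "g i j = \<pi> i j * \<pi> j i / (\<pi> i j + \<pi> j i)" for i j
  define s where "s i j = \<pi> i j + \<pi> j i" for i j
  define a where "a = (\<Sum>i\<in>I. p i *\<^sub>R y i)"
  \<comment> \<open>For positive \<open>s i j\<close> this is \<open>s i j\<close> times the squared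
    distance from \<open>a\<close> to the weighted barycentre of \<open>y i\<close> and
    \<open>y j\<close>.\<close>
  define T where "T i j = (norm (\<pi> i j *\<^sub>R (y i - a) + \<pi> j i *\<^sub>R (y j - a)))\<^sup>2 / s i j" for i j
  define Tot where "Tot = (\<Sum>i\<in>I. \<Sum>j\<in>I. T i j)"
  define G where "G = (\<Sum>i\<in>U. \<Sum>j\<in>V. g i j)"
  define \<eta> where "\<eta> = (\<Sum>i\<in>F. p i + q i)"
  define P5 P6 Q5 Q6 where "P5 = sum p U" and "P6 = sum p V" and "Q5 = sum q U" and "Q6 = sum q V"
  have s0: "0 \<le> s i j" if "i \<in> I" "j \<in> I" for i j using nn that by (simp add: s_def)
  have T0: "0 \<le> T i j" if "i \<in> I" "j \<in> I" for i j using s0 that by (simp add: T_def)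
  have g0: "0 \<le> g i j" if "i \<in> I" "j \<in> I" for i j using nn that by (simp add: g_def)
  have P0: "0 \<le> P5" "0 \<le> P6" "0 \<le> Q5" "0 \<le> Q6"
    unfolding P5_def P6_def Q5_def Q6_def using pq sub by (auto intro!: sum_nonneg)
  have G0: "0 \<le> G" unfolding G_def using g0 sub by (intro sum_nonneg) auto
  have \<eta>0: "0 \<le> sum p F" "0 \<le> sum q F" using pq sub by (auto intro!: sum_nonneg)
  \<comment> \<open>\<open>p + q\<close> has total mass 2, of which \<open>\<eta>\<close> lies on
    \<open>F\<close>.\<close>
  have \<eta>: "P5 + P6 + Q5 + Q6 - 1 = 1 - \<eta>" and le1: "P5 + P6 \<le> 1" "Q5 + Q6 \<le> 1"
    using split[of p] split[of q] p q \<eta>0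
    by (auto simp: P5_def P6_def Q5_def Q6_def \<eta>_def sum.distrib)
  have sum_le: "(\<Sum>i\<in>X. \<Sum>j\<in>Y. \<pi> i j) \<le> sum p X + sum q X" if "X \<subseteq> I" "Y \<subseteq> I" for X Y
  proof -
    have "(\<Sum>i\<in>X. \<Sum>j\<in>Y. \<pi> i j) \<le> (\<Sum>i\<in>X. \<Sum>j\<in>I. \<pi> i j)"
      using that nn fin by (intro sum_mono sum_mono2) auto
    also have "\<dots> = (\<Sum>i\<in>X. p i + q i)" using that row by (intro sum.cong) auto
    finally show ?thesis by (simp add: sum.distrib)
  qed
  \<comment> \<open>The harmonic bound applies to the families \<open>\<pi> i j\<close> and
    \<open>\<pi> j i\<close>, whose totals are parts of the row sums over \<open>U\<close> and over
    \<open>V\<close>.\<close>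
  have "G * (P5 + Q5 + (P6 + Q6)) \<le> (P5 + Q5) * (P6 + Q6)"
  proof -
    have "(\<Sum>e\<in>U \<times> V. \<pi> (fst e) (snd e)) \<le> P5 + Q5"
      using sum_le[OF sub(1,2)] by (simp add: sum.cartesian_product P5_def Q5_def case_prod_beta)
    moreover have "(\<Sum>e\<in>U \<times> V. \<pi> (snd e) (fst e)) \<le> P6 + Q6"
      using sum_le[OF sub(2,1)] sum.swap[of \<pi> U V]
      by (subst (asm) sum.swap) (simp add: sum.cartesian_product P6_def Q6_def case_prod_beta)
    ultimately have "(\<Sum>e\<in>U \<times> V. \<pi> (fst e) (snd e) * \<pi> (snd e) (fst e) / (\<pi> (fst e) (snd e) + \<pi> (snd e) (fst e)))
        * (P5 + Q5 + (P6 + Q6)) \<le> (P5 + Q5) * (P6 + Q6)"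
      using sub nn by (intro sum_harmonic_le) (auto simp: subset_iff)
    then show ?thesis by (simp add: G_def g_def sum.cartesian_product case_prod_beta)
  qed
  from cross_products_ge[OF P0 G0 le1 this] have R: "G * (1 - \<eta>) \<le> P5 * Q6 + P6 * Q5"
    unfolding \<eta> .
  have key: "c / 2 * (g i j * \<pi> k l) \<le> s k l * T i j + s i j * T k l"
    if "i \<in> U" "j \<in> V" "k \<in> F" "l \<in> I" for i j k l
  proof -
    have mem: "i \<in> I" "j \<in> I" "k \<in> I" "l \<in> I" and yy: "y i = u" "y j = v" "y k \<in> W"
      using that by (auto simp: U_def V_def F_def)
    note n = nn[OF mem(1,2)] nn[OF mem(2,1)] nn[OF mem(3,4)] nn[OF mem(4,3)]
    have rhs: "0 \<le> s k l * T i j + s i j * T k l" using s0 T0 mem by simp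
    show ?thesis
    proof (cases "s i j = 0 \<or> s k l = 0")
      case True
      then have "c / 2 * (g i j * \<pi> k l) = 0" using n by (auto simp: g_def s_def add_nonneg_eq_0_iff)
      then show ?thesis using rhs by (simp only:)
    next
      case False
      then have pos: "0 < s i j" "0 < s k l"
        using s0[OF mem(1,2)] s0[OF mem(3,4)] by auto
      let ?V = "s k l *\<^sub>R (\<pi> i j *\<^sub>R u + \<pi> j i *\<^sub>R v) - s i j *\<^sub>R (\<pi> k l *\<^sub>R y k + \<pi> l k *\<^sub>R y l)"
      have "c / 2 * (g i j * \<pi> k l) = c * (\<pi> i j * \<pi> j i * \<pi> k l * s k l) / (2 * s i j * s k l)"
        using pos by (simp add: g_def s_def)
      also have "\<dots> \<le> (norm ?V)\<^sup>2 / (2 * s i j * s k l)"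
        using sep[OF yy(3) y[OF mem(4)]] n pos
        by (intro divide_right_mono) (auto simp: separated_by_def s_def)
      \<comment> \<open>The terms in \<open>a\<close> cancel, since \<open>a\<close> has the weight
        \<open>s i j * s k l\<close> on both sides.\<close>
      also have "?V = s k l *\<^sub>R (\<pi> i j *\<^sub>R (y i - a) + \<pi> j i *\<^sub>R (y j - a)) -
          s i j *\<^sub>R (\<pi> k l *\<^sub>R (y k - a) + \<pi> l k *\<^sub>R (y l - a))"
        by (simp add: s_def yy algebra_simps)
      also have "(norm \<dots>)\<^sup>2 / (2 * s i j * s k l) \<le> s k l * T i j + s i j * T k l"
        unfolding T_def by (rule sum_weighted_squares_ge_diff[OF pos])
      finally show ?thesis .
    qed
  qed
  \<comment> \<open>Summing \<open>key\<close> over \<open>U \<times> V\<close> and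
    \<open>F \<times> I\<close> gives the product of \<open>G\<close> and \<open>\<eta>\<close> on
    the left, because whole rows over \<open>F\<close> are summed. On the right, after enlarging
    both index sets to \<open>I \<times> I\<close>, each of the two terms sums to
    \<open>4 * Tot\<close>.\<close>
  have sT: "c / 2 * (G * \<eta>) \<le> 8 * Tot"
  proof -
    \<comment> \<open>The row sums give \<open>\<pi>\<close> the total 2, and \<open>s\<close>
      counts it twice.\<close>
    have total: "(\<Sum>f\<in>I\<times>I. s (fst f) (snd f)) = 4"
    proof -
      have "(\<Sum>i\<in>I. \<Sum>j\<in>I. \<pi> i j) = 2" using p q by (simp add: row sum.distrib)
      moreover have "(\<Sum>i\<in>I. \<Sum>j\<in>I. \<pi> j i) = (\<Sum>i\<in>I. \<Sum>j\<in>I. \<pi> i j)" by (rule sum.swap)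
      ultimately have "(\<Sum>i\<in>I. \<Sum>j\<in>I. s i j) = 4" by (simp add: s_def sum.distrib)
      then show ?thesis by (simp add: sum.cartesian_product case_prod_beta)
    qed
    have TotT: "(\<Sum>f\<in>I\<times>I. T (fst f) (snd f)) = Tot"
      by (simp add: Tot_def sum.cartesian_product case_prod_beta)
    have "(\<Sum>f\<in>F\<times>I. \<pi> (fst f) (snd f)) = (\<Sum>k\<in>F. \<Sum>l\<in>I. \<pi> k l)"
      by (simp add: sum.cartesian_product case_prod_beta)
    also have "\<dots> = \<eta>" unfolding \<eta>_def using sub row by (intro sum.cong) auto
    finally have \<eta>': "\<eta> = (\<Sum>f\<in>F\<times>I. \<pi> (fst f) (snd f))" by simp
    have G': "G = (\<Sum>e\<in>U\<times>V. g (fst e) (snd e))"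
      by (simp add: G_def sum.cartesian_product case_prod_beta)
    have "c / 2 * (G * \<eta>) =
        (\<Sum>e\<in>U\<times>V. \<Sum>f\<in>F\<times>I. c / 2 * (g (fst e) (snd e) * \<pi> (fst f) (snd f)))"
      unfolding G' \<eta>' sum_product by (simp add: sum_distrib_left)
    also have "\<dots> \<le> (\<Sum>e\<in>U\<times>V. \<Sum>f\<in>F\<times>I.
        s (fst f) (snd f) * T (fst e) (snd e) + s (fst e) (snd e) * T (fst f) (snd f))"
      using key by (intro sum_mono) auto
    also have "\<dots> \<le> (\<Sum>e\<in>U\<times>V. \<Sum>f\<in>I\<times>I.
        s (fst f) (snd f) * T (fst e) (snd e) + s (fst e) (snd e) * T (fst f) (snd f))"
      using sub s0 T0 fin by (intro sum_mono sum_mono2) (auto simp: subset_iff)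
    also have "\<dots> \<le> (\<Sum>e\<in>I\<times>I. \<Sum>f\<in>I\<times>I.
        s (fst f) (snd f) * T (fst e) (snd e) + s (fst e) (snd e) * T (fst f) (snd f))"
      using sub s0 T0 fin by (intro sum_mono2) (auto simp: subset_iff intro!: sum_nonneg)
    also have "\<dots> = 8 * Tot"
      by (simp add: sum.distrib total TotT flip: sum_distrib_left sum_distrib_right)
    finally show ?thesis .
  qed
  \<comment> \<open>\<open>sT\<close> amounts to \<open>c * (G * \<eta>) \<le> 16 * Tot\<close>, so
    the factor 32 in the bound on \<open>\<delta>\<close> leaves
    \<open>2 * \<delta> * (G * \<eta>) \<le> Tot\<close>.\<close>
  have "\<delta> * (2 * G) \<le> 2 * (\<delta> * (P5 * Q6 + P6 * Q5)) + Tot"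
  proof -
    have Tot0: "0 \<le> Tot" unfolding Tot_def using T0 by (intro sum_nonneg)
    have "0 \<le> G * \<eta>" using G0 \<eta>0 by (simp add: \<eta>_def sum.distrib)
    with \<delta>(2) have "32 * \<delta> * (G * \<eta>) \<le> c * (G * \<eta>)" by (rule mult_right_mono)
    moreover have "\<delta> * (G * (1 - \<eta>)) \<le> \<delta> * (P5 * Q6 + P6 * Q5)"
      using R \<delta>(1) by (rule mult_left_mono)
    ultimately show ?thesis using sT by (simp add: algebra_simps)
  qed
  moreover have "(\<Sum>i\<in>I. \<Sum>j\<in>I. g i j * D i j) =
      (\<Sum>i\<in>I. \<Sum>j\<in>I. g i j * (norm (y i - y j))\<^sup>2) + \<delta> * (2 * G)"
  proof -
    have "(\<Sum>i\<in>V. \<Sum>j\<in>U. g i j) = G"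
      unfolding G_def by (subst sum.swap) (simp add: g_def add.commute mult.commute)
    then have "(\<Sum>i\<in>U. \<Sum>j\<in>V. g i j) + (\<Sum>i\<in>V. \<Sum>j\<in>U. g i j) = 2 * G"
      unfolding G_def by simp
    then show ?thesis using stretch[of g] by (simp only:)
  qed
  moreover have "(\<Sum>i\<in>I. \<Sum>j\<in>I. p i * q j * D i j) =
      (\<Sum>i\<in>I. \<Sum>j\<in>I. p i * q j * (norm (y i - y j))\<^sup>2) + \<delta> * (P5 * Q6 + P6 * Q5)"
    using stretch[of "\<lambda>i j. p i * q j"]
    by (simp only: P5_def P6_def Q5_def Q6_def sum_product)
  moreover have "(\<Sum>i\<in>I. \<Sum>j\<in>I. p i * q j * (norm (y i - y j))\<^sup>2) =
      1/2 * (\<Sum>i\<in>I. \<Sum>j\<in>I. g i j * (norm (y i - y j))\<^sup>2) + 1/2 * Tot"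
    unfolding g_def Tot_def T_def s_def by (rule euclidean_ANN_defect[OF p q nn row a_def])
  ultimately show ?thesis
    unfolding g_def[symmetric] by linarith
qed

text \<open>The quantity bounded by \<open>c\<close> is 32 times the increase of the squared
  distance, \<open>(norm (u - v) + \<epsilon>)\<^sup>2 - (norm (u - v))\<^sup>2\<close>, which
  serves as \<open>\<delta>\<close> in \<open>ANN_of_separated\<close>.\<close>

lemma ANN_inequalities_stretched_dist:
  fixes u v :: "'a::real_inner"
  assumes uvW: "u \<noteq> v" "u \<notin> W" "v \<notin> W"
    and sep: "\<And>k l. \<lbrakk>k \<in> W; l \<in> insert u (insert v W)\<rbrakk> \<Longrightarrow> separated_by c u v k l"
    and \<epsilon>: "0 \<le> \<epsilon>" "32 * (2 * norm (u - v) * \<epsilon> + \<epsilon>\<^sup>2) \<le> c"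
  shows "ANN_inequalities n (insert u (insert v W)) (stretched_dist u v \<epsilon>)"
  unfolding ANN_inequalities_def
proof (intro allI impI)
  fix y p q and \<pi> :: "nat \<Rightarrow> nat \<Rightarrow> real"
  assume y: "\<forall>i\<in>{1..n}. y i \<in> insert u (insert v W)"
    and pq: "\<forall>i\<in>{1..n}. 0 \<le> p i \<and> 0 \<le> q i"
    and p: "(\<Sum>i=1..n. p i) = 1" and q: "(\<Sum>j=1..n. q j) = 1"
    and nn: "\<forall>i\<in>{1..n}. \<forall>j\<in>{1..n}. 0 \<le> \<pi> i j"
    and row: "\<forall>i\<in>{1..n}. (\<Sum>k=1..n. \<pi> i k) = p i + q i"
  let ?d = "stretched_dist u v \<epsilon>"
  let ?\<delta> = "2 * norm (u - v) * \<epsilon> + \<epsilon>\<^sup>2"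
  have d: "(?d z w)\<^sup>2 = (norm (z - w))\<^sup>2 + (if {z, w} = {u, v} then ?\<delta> else 0)" for z w
    by (auto simp: stretched_dist_def power2_sum doubleton_eq_iff norm_minus_commute)
  let ?f = "\<lambda>i j. \<pi> i j * \<pi> j i / (\<pi> i j + \<pi> j i) * (?d (y i) (y j))\<^sup>2"
  let ?S = "{(i, j). i \<in> {1..n} \<and> j \<in> {1..n} \<and> \<pi> i j + \<pi> j i > 0}"
  \<comment> \<open>A pair outside \<open>?S\<close> has both entries of \<open>\<pi>\<close> equal
    to 0 by nonnegativity, hence a zero term.\<close>
  have "(\<Sum>(i, j)\<in>?S. ?f i j) = (\<Sum>(i, j)\<in>{1..n} \<times> {1..n}. ?f i j)"
  proof (rule sum.mono_neutral_left)
    have "?f i j = 0" if "i \<in> {1..n}" "j \<in> {1..n}" "\<not> 0 < \<pi> i j + \<pi> j i" for i j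
    proof -
      have "0 \<le> \<pi> i j" "0 \<le> \<pi> j i" using nn that(1,2) by blast+
      then have "\<pi> i j + \<pi> j i = 0" using that(3) by linarith
      then show ?thesis by simp
    qed
    then have "(case e of (i, j) \<Rightarrow> ?f i j) = 0" if "e \<in> {1..n} \<times> {1..n} - ?S" for e
      using that by (cases e) (simp del: mult_eq_0_iff divide_eq_0_iff)
    then show "\<forall>e\<in>{1..n} \<times> {1..n} - ?S. (case e of (i, j) \<Rightarrow> ?f i j) = 0" ..
  qed auto
  also have "\<dots> = (\<Sum>i=1..n. \<Sum>j=1..n. ?f i j)" by (simp add: sum.cartesian_product)
  finally have eq: "(\<Sum>(i, j)\<in>?S. ?f i j) = (\<Sum>i=1..n. \<Sum>j=1..n. ?f i j)" .
  have "1 / 2 * (\<Sum>i=1..n. \<Sum>j=1..n. ?f i j) \<le> (\<Sum>i=1..n. \<Sum>j=1..n. p i * q j * (?d (y i) (y j))\<^sup>2)"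
    unfolding d
  proof (rule ANN_of_separated[OF _ _ _ p q _ _ _ uvW sep])
    show "0 \<le> ?\<delta>" using \<epsilon>(1) by simp
    show "32 * ?\<delta> \<le> c" by (rule \<epsilon>(2))
  qed (use y pq nn row in blast)+
  then show "1 / 2 * (\<Sum>(i, j)\<in>?S. ?f i j) \<le> (\<Sum>i=1..n. \<Sum>j=1..n. p i * q j * (?d (y i) (y j))\<^sup>2)"
    unfolding eq .
qed

section \<open>The six points in space\<close>

theorem theorem4p1:
  fixes x :: "nat \<Rightarrow> real ^ 3"
  assumes distinct: "inj_on x {1..6}"
    and diagonals: "card (open_segment (x 1) (x 3) \<inter> open_segment (x 2) (x 4)) = 1"
    and crossing: "card (open_segment (x 5) (x 6) \<inter>
        (convex hull {x 1, x 2, x 3, x 4} -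
          (\<Union>(i, j) \<in> {(i, j). i \<in> {1..4} \<and> j \<in> {1..4} \<and> i \<noteq> j}. closed_segment (x i) (x j)))) = 1"
  shows "\<exists>C::real. C > 0 \<and> (\<forall>\<epsilon>\<in>{0<..C}.
      Semimetric_space (x ` {1..6}) (stretched_dist (x 5) (x 6) \<epsilon>) \<and>
      (\<forall>n\<ge>1. ANN_inequalities n (x ` {1..6}) (stretched_dist (x 5) (x 6) \<epsilon>)))"
proof -
  let ?u = "x 5" and ?v = "x 6" and ?W = "x ` {1..4}"
  let ?J = "{(i, j). i \<in> {1..4::nat} \<and> j \<in> {1..4} \<and> i \<noteq> j}"
  let ?E = "\<Union>(i, j)\<in>?J. closed_segment (x i) (x j)"
  have "{1..4::nat} = {1,2,3,4}" "{1..6::nat} = insert 5 (insert 6 {1..4})" by auto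
  then have W: "{x 1, x 2, x 3, x 4} = ?W" and L: "x ` {1..6} = insert ?u (insert ?v ?W)"
    by auto
  have uv: "?u \<noteq> ?v" using inj_onD[OF distinct, of 5 6] by auto
  obtain w where S: "open_segment ?u ?v \<inter> (convex hull ?W - ?E) = {w}"
    using crossing unfolding W by (auto simp: card_1_singleton_iff)
  have "finite ?J" by (rule finite_subset[of _ "{1..4} \<times> {1..4}"]) auto
  then have E: "closed ?E" by (intro closed_UN) auto
  have WE: "closed_segment k l \<subseteq> ?E" if kl: "k \<in> ?W" "l \<in> ?W" for k l
  proof (cases "k = l")
    case True
    obtain i where i: "i \<in> {1..4}" "k = x i" using kl by blast
    \<comment> \<open>\<open>?E\<close> is built from pairs of different indices, so a single vertex
      is covered as an end point of a segment to another vertex.\<close>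
    define j :: nat where "j = (if i = 1 then 2 else 1)"
    have "(i, j) \<in> ?J" "k \<in> closed_segment (x i) (x j)" using i by (auto simp: j_def)
    then show ?thesis using True by auto
  next
    case False
    then show ?thesis using kl by (fastforce intro!: UN_I)
  qed
  have sep_ex: "?u \<notin> ?W \<and> ?v \<notin> ?W \<and>
      (\<exists>c>0. \<forall>(k, l)\<in>?W \<times> insert ?u (insert ?v ?W). separated_by c ?u ?v k l)"
    by (rule crossing_segment_separated[OF uv _ S E WE]) simp_all
  then obtain c where c: "c > 0"
    and sep: "\<forall>(k, l)\<in>?W \<times> insert ?u (insert ?v ?W). separated_by c ?u ?v k l"
    by blast
  have uvW: "?u \<notin> ?W" "?v \<notin> ?W" using sep_ex by simp_all
  have sep: "separated_by c ?u ?v k l" if "k \<in> ?W" "l \<in> insert ?u (insert ?v ?W)" for k l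
    using sep that by blast
  let ?D = "2 * norm (?u - ?v) + 1"
  \<comment> \<open>For \<open>\<epsilon> \<le> 1\<close> the squared distance grows by at most
    \<open>\<epsilon> * ?D\<close>, and the second bound keeps this at most
    \<open>c / 32\<close>.\<close>
  define C where "C = min 1 (c / (32 * ?D))"
  have D: "?D > 0" by (simp add: add_nonneg_pos)
  have C: "C > 0" using c D by (simp add: C_def)
  moreover have "32 * (2 * norm (?u - ?v) * \<epsilon> + \<epsilon>\<^sup>2) \<le> c" if "\<epsilon> \<in> {0<..C}" for \<epsilon>
  proof -
    have \<epsilon>: "0 < \<epsilon>" "\<epsilon> \<le> 1" "\<epsilon> \<le> c / (32 * ?D)" using that by (auto simp: C_def)
    have "\<epsilon>\<^sup>2 \<le> \<epsilon>" using \<epsilon> by (simp add: power2_eq_square mult_left_le)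
    then have "32 * (2 * norm (?u - ?v) * \<epsilon> + \<epsilon>\<^sup>2) \<le> \<epsilon> * (32 * ?D)" by (simp add: algebra_simps)
    also have "\<dots> \<le> c" using \<epsilon>(3) D by (subst (asm) pos_le_divide_eq) auto
    finally show ?thesis .
  qed
  ultimately show ?thesis
    unfolding L
    using Semimetric_space_stretched_dist[OF uv] ANN_inequalities_stretched_dist[OF uv uvW sep]
    by (intro exI[of _ C] conjI ballI allI impI) (simp_all only: greaterThanAtMost_iff less_imp_le)
qed

end
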